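(* Let $\phi : X\to Y$ be a continuous map of topological spaces and let $\mathcal{G}$ be a sheaf of abelian groups on $X$. Let $i : X\to\mathrm{Filt}\,X$ be the canonical map $x\mapsto U(x)$ and let $\psi : Y\to\mathrm{Filt}\,X$ be the canonical map sending $y$ to the filter generated by $\{\phi^{-1}(V): V\subseteq Y\text{ open}, y\in V\}$. Then (canonically) $$\phi_\ast\mathcal{G}=\psi^{-1}(i_\ast\mathcal{G}).$$
   Context: A topological filter on a topological space $X$ is a set $F$ of open subsets of $X$ with $X\in F$, closed under finite intersections, and containing with each $U\in F$ every open set $U'\supseteq U$ (the set of all open subsets is allowed). $\mathrm{Filt}\,X$ is the set of all topological filters on $X$ with the topology having as basis the sets $D(U)=\{F:U\in F\}$, $U\subseteq X$ open. $U(x)$ is the filter of open neighborhoods of $x$. The filter generated by a set of open sets is the smallest topological filter containing it. The maps $i$ and $\psi$ are continuous. $\phi_\ast$ denotes the direct image and $\psi^{-1}$ the inverse image of sheaves of abelian groups. *)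

theory Defs
  imports "HOL-Analysis.Abstract_Topology" "HOL-Algebra.Product_Groups"
begin

section \<open>Presheaves and sheaves of abelian groups\<close>

text \<open>All groups of sections live in one type \<open>'g\<close>, each with its own carrier; the abelian groups
  are the multiplicatively written \<^const>\<open>comm_group\<close>s of HOL-Algebra.\<close>

record ('a, 'g) presheaf =
  Sec :: "'a set \<Rightarrow> 'g monoid"
  Res :: "'a set \<Rightarrow> 'a set \<Rightarrow> 'g \<Rightarrow> 'g"  \<comment> \<open>\<open>Res F U V\<close> restricts from \<open>U\<close> to \<open>V \<subseteq> U\<close>\<close>

locale ab_presheaf =
  fixes X :: "'a topology" and F :: "('a, 'g) presheaf"
  assumes Sec_group: "openin X U \<Longrightarrow> comm_group (Sec F U)"
    and Res_hom: "\<lbrakk>openin X U; openin X V; V \<subseteq> U\<rbrakk> \<Longrightarrow> Res F U V \<in> hom (Sec F U) (Sec F V)"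
    and Res_id: "\<lbrakk>openin X U; s \<in> carrier (Sec F U)\<rbrakk> \<Longrightarrow> Res F U U s = s"
    and Res_Res: "\<lbrakk>openin X U; openin X V; openin X W; W \<subseteq> V; V \<subseteq> U; s \<in> carrier (Sec F U)\<rbrakk>
      \<Longrightarrow> Res F V W (Res F U V s) = Res F U W s"

text \<open>Covers are sets of open sets rather than indexed families. This is no restriction: in a
  compatible indexed family, sections over equal members of the cover agree. The empty cover of
  the empty set is included, so \<open>Sec F {}\<close> is trivial.\<close>

locale ab_sheaf = ab_presheaf +
  assumes locality: "\<lbrakk>\<And>U. U \<in> C \<Longrightarrow> openin X U; s \<in> carrier (Sec F (\<Union>C)); t \<in> carrier (Sec F (\<Union>C));
        \<And>U. U \<in> C \<Longrightarrow> Res F (\<Union>C) U s = Res F (\<Union>C) U t\<rbrakk>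
      \<Longrightarrow> s = t"
    and gluing: "\<lbrakk>\<And>U. U \<in> C \<Longrightarrow> openin X U; \<And>U. U \<in> C \<Longrightarrow> f U \<in> carrier (Sec F U);
        \<And>U V. \<lbrakk>U \<in> C; V \<in> C\<rbrakk> \<Longrightarrow> Res F U (U \<inter> V) (f U) = Res F V (U \<inter> V) (f V)\<rbrakk>
      \<Longrightarrow> \<exists>s \<in> carrier (Sec F (\<Union>C)). \<forall>U\<in>C. Res F (\<Union>C) U s = f U"

definition presheaf_morphism ::
    "'a topology \<Rightarrow> ('a, 'g) presheaf \<Rightarrow> ('a, 'h) presheaf \<Rightarrow> ('a set \<Rightarrow> 'g \<Rightarrow> 'h) \<Rightarrow> bool" where
  "presheaf_morphism X F G \<alpha> \<longleftrightarrow>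
    (\<forall>U. openin X U \<longrightarrow> \<alpha> U \<in> hom (Sec F U) (Sec G U)) \<and>
    (\<forall>U V. openin X U \<longrightarrow> openin X V \<longrightarrow> V \<subseteq> U \<longrightarrow>
      (\<forall>s \<in> carrier (Sec F U). \<alpha> V (Res F U V s) = Res G U V (\<alpha> U s)))"

definition sheaf_isomorphism ::
    "'a topology \<Rightarrow> ('a, 'g) presheaf \<Rightarrow> ('a, 'h) presheaf \<Rightarrow> ('a set \<Rightarrow> 'g \<Rightarrow> 'h) \<Rightarrow> bool" where
  "sheaf_isomorphism X F G \<alpha> \<longleftrightarrow>
    ab_sheaf X F \<and> ab_sheaf X G \<and> presheaf_morphism X F G \<alpha> \<and>
    (\<exists>\<beta>. presheaf_morphism X G F \<beta> \<and>
      (\<forall>U. openin X U \<longrightarrow>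
        (\<forall>s \<in> carrier (Sec F U). \<beta> U (\<alpha> U s) = s) \<and>
        (\<forall>t \<in> carrier (Sec G U). \<alpha> U (\<beta> U t) = t)))"


section \<open>Direct image\<close>

definition preimage_in :: "'a topology \<Rightarrow> ('a \<Rightarrow> 'b) \<Rightarrow> 'b set \<Rightarrow> 'a set" where
  "preimage_in X f V = {x \<in> topspace X. f x \<in> V}"

definition direct_image ::
    "'a topology \<Rightarrow> ('a \<Rightarrow> 'b) \<Rightarrow> ('a, 'g) presheaf \<Rightarrow> ('b, 'g) presheaf" where
  "direct_image X f F =
    \<lparr>Sec = (\<lambda>V. Sec F (preimage_in X f V)),
     Res = (\<lambda>V W. Res F (preimage_in X f V) (preimage_in X f W))\<rparr>"


section \<open>Direct limits of sections\<close>

text \<open>The direct limit of the groups \<open>Sec F U\<close> over a set \<open>I\<close> of open sets that is nonempty and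
  closed under binary intersections; its elements are the classes of pairs \<open>(U, s)\<close> with
  \<open>U \<in> I\<close> and \<open>s\<close> a section over \<open>U\<close>. The unions in the group operations
  are unions of one and the same class, taken over all choices of representatives.\<close>

definition germ_rel ::
    "('a, 'g) presheaf \<Rightarrow> 'a set set \<Rightarrow> (('a set \<times> 'g) \<times> ('a set \<times> 'g)) set" where
  "germ_rel F I = {((U, s), (V, t)). U \<in> I \<and> V \<in> I \<and> s \<in> carrier (Sec F U) \<and> t \<in> carrier (Sec F V) \<and>
     (\<exists>W \<in> I. W \<subseteq> U \<inter> V \<and> Res F U W s = Res F V W t)}"

definition germ :: "('a, 'g) presheaf \<Rightarrow> 'a set set \<Rightarrow> 'a set \<Rightarrow> 'g \<Rightarrow> ('a set \<times> 'g) set" where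
  "germ F I U s = germ_rel F I `` {(U, s)}"

definition direct_limit :: "('a, 'g) presheaf \<Rightarrow> 'a set set \<Rightarrow> ('a set \<times> 'g) set monoid" where
  "direct_limit F I =
    \<lparr>carrier = (SIGMA U:I. carrier (Sec F U)) // germ_rel F I,
     monoid.mult = (\<lambda>A B. \<Union>{germ F I U (s \<otimes>\<^bsub>Sec F U\<^esub> t) |U s t. (U, s) \<in> A \<and> (U, t) \<in> B}),
     one = (\<Union>U\<in>I. germ F I U \<one>\<^bsub>Sec F U\<^esub>)\<rparr>"

definition open_nbhds :: "'a topology \<Rightarrow> 'a \<Rightarrow> 'a set set" where
  "open_nbhds X x = {U. openin X U \<and> x \<in> U}"

definition stalk :: "'a topology \<Rightarrow> ('a, 'g) presheaf \<Rightarrow> 'a \<Rightarrow> ('a set \<times> 'g) set monoid" where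
  "stalk X F x = direct_limit F (open_nbhds X x)"


section \<open>Sheafification\<close>

definition stalk_germs ::
    "'a topology \<Rightarrow> ('a, 'g) presheaf \<Rightarrow> 'a set \<Rightarrow> 'g \<Rightarrow> 'a \<Rightarrow> ('a set \<times> 'g) set" where
  "stalk_germs X F U s = (\<lambda>x\<in>U. germ F (open_nbhds X x) U s)"

definition sheafification ::
    "'a topology \<Rightarrow> ('a, 'g) presheaf \<Rightarrow> ('a, 'a \<Rightarrow> ('a set \<times> 'g) set) presheaf" where
  "sheafification X F =
    \<lparr>Sec = (\<lambda>U. (product_group U (stalk X F))
        \<lparr>carrier := {\<sigma> \<in> carrier (product_group U (stalk X F)).
           \<forall>x\<in>U. \<exists>V. openin X V \<and> x \<in> V \<and> V \<subseteq> U \<and>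
             (\<exists>s \<in> carrier (Sec F V). restrict \<sigma> V = stalk_germs X F V s)}\<rparr>),
     Res = (\<lambda>U V \<sigma>. restrict \<sigma> V)\<rparr>"


section \<open>Inverse image\<close>

text \<open>For \<open>f\<close> from \<open>Y\<close> to \<open>Z\<close> and \<open>H\<close> on \<open>Z\<close>, the inverse image is the sheafification of
  \<open>V \<mapsto> colim H W\<close>, the limit being over the open \<open>W\<close> containing \<open>f ` V\<close>.\<close>

definition open_nbhds_image :: "'z topology \<Rightarrow> ('y \<Rightarrow> 'z) \<Rightarrow> 'y set \<Rightarrow> 'z set set" where
  "open_nbhds_image Z f V = {W. openin Z W \<and> f ` V \<subseteq> W}"

definition inverse_image_presheaf ::
    "'z topology \<Rightarrow> ('y \<Rightarrow> 'z) \<Rightarrow> ('z, 'g) presheaf \<Rightarrow> ('y, ('z set \<times> 'g) set) presheaf" where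
  "inverse_image_presheaf Z f H =
    \<lparr>Sec = (\<lambda>V. direct_limit H (open_nbhds_image Z f V)),
     Res = (\<lambda>V V' A. \<Union>(W, s)\<in>A. germ H (open_nbhds_image Z f V') W s)\<rparr>"

definition inverse_image ::
    "'y topology \<Rightarrow> 'z topology \<Rightarrow> ('y \<Rightarrow> 'z) \<Rightarrow> ('z, 'g) presheaf \<Rightarrow>
      ('y, 'y \<Rightarrow> ('y set \<times> ('z set \<times> 'g) set) set) presheaf" where
  "inverse_image Y Z f H = sheafification Y (inverse_image_presheaf Z f H)"


section \<open>The space of topological filters\<close>

definition topological_filter :: "'a topology \<Rightarrow> 'a set set \<Rightarrow> bool" where
  "topological_filter X F \<longleftrightarrow>
    (\<forall>U\<in>F. openin X U) \<and> topspace X \<in> F \<and> (\<forall>U\<in>F. \<forall>V\<in>F. U \<inter> V \<in> F) \<and>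
    (\<forall>U\<in>F. \<forall>U'. openin X U' \<and> U \<subseteq> U' \<longrightarrow> U' \<in> F)"

definition Filt_basic :: "'a topology \<Rightarrow> 'a set \<Rightarrow> 'a set set set" where
  "Filt_basic X U = {F. topological_filter X F \<and> U \<in> F}"

definition Filt :: "'a topology \<Rightarrow> 'a set set topology" where
  "Filt X = topology (arbitrary union_of (\<lambda>D. \<exists>U. openin X U \<and> D = Filt_basic X U))"

definition generated_filter :: "'a topology \<Rightarrow> 'a set set \<Rightarrow> 'a set set" where
  "generated_filter X S = \<Inter>{F. topological_filter X F \<and> S \<subseteq> F}"

definition filter_of_map :: "'a topology \<Rightarrow> 'b topology \<Rightarrow> ('a \<Rightarrow> 'b) \<Rightarrow> 'b \<Rightarrow> 'a set set" where
  "filter_of_map X Y \<phi> y = generated_filter X (preimage_in X \<phi> ` open_nbhds Y y)"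

lemma Filt_basic_Int:
  assumes "openin X U" "openin X V"
  shows "Filt_basic X U \<inter> Filt_basic X V = Filt_basic X (U \<inter> V)"
  using assms unfolding Filt_basic_def topological_filter_def
  by (auto intro: Int_lower1 Int_lower2)

lemma openin_Filt:
  "openin (Filt X) = arbitrary union_of (\<lambda>D. \<exists>U. openin X U \<and> D = Filt_basic X U)"
  unfolding Filt_def
proof (intro topology_inverse' istopology_base)
  fix D E
  assume "\<exists>U. openin X U \<and> D = Filt_basic X U" "\<exists>V. openin X V \<and> E = Filt_basic X V"
  then obtain U V where "openin X U" "openin X V" "D = Filt_basic X U" "E = Filt_basic X V"
    by blast
  then have "openin X (U \<inter> V) \<and> D \<inter> E = Filt_basic X (U \<inter> V)"
    by (simp add: Filt_basic_Int openin_Int)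
  then show "\<exists>W. openin X W \<and> D \<inter> E = Filt_basic X W" ..
qed

lemma openin_Filt_basic: "openin X U \<Longrightarrow> openin (Filt X) (Filt_basic X U)"
  unfolding openin_Filt by (rule arbitrary_union_of_inc) blast

lemma openin_Filt_obtain:
  assumes "openin (Filt X) W"
  obtains \<D> where "\<And>D. D \<in> \<D> \<Longrightarrow> \<exists>U. openin X U \<and> D = Filt_basic X U" "W = \<Union>\<D>"
  using assms unfolding openin_Filt union_of_def by auto

lemma topspace_Filt: "topspace (Filt X) = Collect (topological_filter X)"
proof
  show "topspace (Filt X) \<subseteq> Collect (topological_filter X)"
  proof
    fix F assume "F \<in> topspace (Filt X)"
    moreover obtain \<D> where \<D>: "\<And>D. D \<in> \<D> \<Longrightarrow> \<exists>U. openin X U \<and> D = Filt_basic X U"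
        "topspace (Filt X) = \<Union>\<D>"
      using openin_Filt_obtain[OF openin_topspace] by metis
    ultimately obtain D where "D \<in> \<D>" "F \<in> D" by auto
    moreover from \<open>D \<in> \<D>\<close> obtain U where "D = Filt_basic X U"
      using \<D>(1) by meson
    ultimately have "F \<in> Filt_basic X U" by simp
    then show "F \<in> Collect (topological_filter X)"
      by (simp add: Filt_basic_def)
  qed
  have "topspace X \<in> F" if "topological_filter X F" for F
    using that by (simp add: topological_filter_def)
  then have "Filt_basic X (topspace X) = Collect (topological_filter X)"
    unfolding Filt_basic_def by blast
  then show "Collect (topological_filter X) \<subseteq> topspace (Filt X)"
    using openin_subset[OF openin_Filt_basic[OF openin_topspace[of X]]] by simp
qed

lemma continuous_map_Filt:
  assumes "\<And>y. y \<in> topspace Y \<Longrightarrow> topological_filter X (f y)"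
    and "\<And>U. openin X U \<Longrightarrow> openin Y {y \<in> topspace Y. U \<in> f y}"
  shows "continuous_map Y (Filt X) f"
proof -
  have "openin Y {y \<in> topspace Y. f y \<in> W}" if W: "openin (Filt X) W" for W
  proof -
    obtain \<D> where \<D>: "\<And>D. D \<in> \<D> \<Longrightarrow> \<exists>U. openin X U \<and> D = Filt_basic X U" "W = \<Union>\<D>"
      using openin_Filt_obtain[OF W] by metis
    have "openin Y {y \<in> topspace Y. f y \<in> D}" if "D \<in> \<D>" for D
    proof -
      obtain U where U: "openin X U" "D = Filt_basic X U"
        using \<D> \<open>D \<in> \<D>\<close> by blast
      then have "{y \<in> topspace Y. f y \<in> D} = {y \<in> topspace Y. U \<in> f y}"
        using assms(1) by (auto simp: Filt_basic_def)
      then show ?thesis using assms(2) U by simp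
    qed
    moreover have "{y \<in> topspace Y. f y \<in> W} = (\<Union>D\<in>\<D>. {y \<in> topspace Y. f y \<in> D})"
      using \<D> by auto
    ultimately show ?thesis by (auto intro: openin_Union)
  qed
  then show ?thesis
    using assms(1) by (auto simp: continuous_map_def topspace_Filt)
qed

lemma topological_filter_open_nbhds: "x \<in> topspace X \<Longrightarrow> topological_filter X (open_nbhds X x)"
  by (auto simp: topological_filter_def open_nbhds_def)

lemma continuous_map_open_nbhds: "continuous_map X (Filt X) (open_nbhds X)"
proof (rule continuous_map_Filt)
  fix U assume U: "openin X U"
  then have "{x \<in> topspace X. U \<in> open_nbhds X x} = U"
    using openin_subset[OF U] by (auto simp: open_nbhds_def)
  then show "openin X {x \<in> topspace X. U \<in> open_nbhds X x}" using U by simp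
qed (rule topological_filter_open_nbhds)

lemma topological_filter_generated:
  assumes "\<And>U. U \<in> S \<Longrightarrow> openin X U"
  shows "topological_filter X (generated_filter X S)"
proof -
  define \<F> where "\<F> = {F. topological_filter X F \<and> S \<subseteq> F}"
  have filt: "topological_filter X F" if "F \<in> \<F>" for F
    using that by (simp add: \<F>_def)
  have "topological_filter X (Collect (openin X))"
    by (auto simp: topological_filter_def intro: openin_Int)
  then have all: "Collect (openin X) \<in> \<F>"
    using assms by (simp add: \<F>_def subset_iff)
  have "topological_filter X (\<Inter>\<F>)"
    unfolding topological_filter_def
  proof (intro conjI ballI allI impI InterI)
    show "openin X U" if "U \<in> \<Inter>\<F>" for U
      using that all by auto
    show "topspace X \<in> F" if "F \<in> \<F>" for F
      using filt[OF that] by (simp add: topological_filter_def)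
    show "U \<inter> V \<in> F" if "U \<in> \<Inter>\<F>" "V \<in> \<Inter>\<F>" "F \<in> \<F>" for U V F
      using filt[OF that(3)] that by (simp add: topological_filter_def)
    show "U' \<in> F" if "U \<in> \<Inter>\<F>" "openin X U' \<and> U \<subseteq> U'" "F \<in> \<F>" for U U' F
      using filt[OF that(3)] that unfolding topological_filter_def by (meson InterD)
  qed
  then show ?thesis
    by (simp add: generated_filter_def \<F>_def)
qed

lemma openin_preimage_in:
  "\<lbrakk>continuous_map X Y f; openin Y V\<rbrakk> \<Longrightarrow> openin X (preimage_in X f V)"
  by (simp add: continuous_map_def preimage_in_def)

lemma topological_filter_of_map:
  assumes "continuous_map X Y \<phi>"
  shows "topological_filter X (filter_of_map X Y \<phi> y)"
  unfolding filter_of_map_def using assms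
  by (intro topological_filter_generated) (auto simp: open_nbhds_def openin_preimage_in)

lemma filter_of_map_eq:
  assumes "continuous_map X Y \<phi>" "y \<in> topspace Y"
  shows "filter_of_map X Y \<phi> y =
    {U. openin X U \<and> (\<exists>V. openin Y V \<and> y \<in> V \<and> preimage_in X \<phi> V \<subseteq> U)}" (is "_ = ?R")
proof
  have pre: "openin X (preimage_in X \<phi> V)" if "openin Y V" for V
    using openin_preimage_in[OF assms(1) that] .
  have "topological_filter X ?R"
    unfolding topological_filter_def
  proof (intro conjI ballI allI impI)
    show "topspace X \<in> ?R" using assms(2) by (auto simp: preimage_in_def)
    show "U \<inter> U' \<in> ?R" if "U \<in> ?R" "U' \<in> ?R" for U U'
    proof -
      obtain V V' where "openin Y V" "y \<in> V" "preimage_in X \<phi> V \<subseteq> U"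
        "openin Y V'" "y \<in> V'" "preimage_in X \<phi> V' \<subseteq> U'"
        using \<open>U \<in> ?R\<close> \<open>U' \<in> ?R\<close> by auto
      then have "openin Y (V \<inter> V') \<and> y \<in> V \<inter> V' \<and> preimage_in X \<phi> (V \<inter> V') \<subseteq> U \<inter> U'"
        by (auto simp: preimage_in_def)
      moreover have "openin X (U \<inter> U')"
        using that by (simp add: openin_Int)
      ultimately show ?thesis by blast
    qed
  qed auto
  moreover have "preimage_in X \<phi> ` open_nbhds Y y \<subseteq> ?R"
    using pre by (auto simp: open_nbhds_def)
  ultimately show "filter_of_map X Y \<phi> y \<subseteq> ?R"
    unfolding filter_of_map_def generated_filter_def by blast
  show "?R \<subseteq> filter_of_map X Y \<phi> y"
  proof
    fix U assume "U \<in> ?R"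
    then obtain V where U: "openin X U" "openin Y V" "y \<in> V" "preimage_in X \<phi> V \<subseteq> U"
      by blast
    have "U \<in> F" if F: "topological_filter X F" "preimage_in X \<phi> ` open_nbhds Y y \<subseteq> F" for F
    proof -
      have "preimage_in X \<phi> V \<in> F"
        using F(2) U by (auto simp: open_nbhds_def)
      then show ?thesis
        using F(1) U unfolding topological_filter_def by blast
    qed
    then show "U \<in> filter_of_map X Y \<phi> y"
      unfolding filter_of_map_def generated_filter_def by blast
  qed
qed

lemma continuous_map_filter_of_map:
  assumes "continuous_map X Y \<phi>"
  shows "continuous_map Y (Filt X) (filter_of_map X Y \<phi>)"
proof (rule continuous_map_Filt)
  fix U assume U: "openin X U"
  have "U \<in> filter_of_map X Y \<phi> y \<longleftrightarrow> (\<exists>V. openin Y V \<and> y \<in> V \<and> preimage_in X \<phi> V \<subseteq> U)"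
    if "y \<in> topspace Y" for y
    using U by (simp add: filter_of_map_eq[OF assms that])
  then have "{y \<in> topspace Y. U \<in> filter_of_map X Y \<phi> y} =
      \<Union>{V. openin Y V \<and> preimage_in X \<phi> V \<subseteq> U}"
    using openin_subset[of Y] by blast
  then show "openin Y {y \<in> topspace Y. U \<in> filter_of_map X Y \<phi> y}"
    by (auto intro: openin_Union)
qed (rule topological_filter_of_map[OF assms])


section \<open>The canonical comparison map\<close>

text \<open>For \<open>V\<close> open in \<open>Y\<close> put \<open>U = preimage_in X \<phi> V\<close>. The basic open set \<open>Filt_basic X U\<close>
  contains the image of \<open>V\<close> under \<open>filter_of_map X Y \<phi>\<close>, and its preimage in \<open>X\<close> under
  \<open>open_nbhds X\<close> is \<open>U\<close> again. So a section of the direct image of \<open>G\<close> under \<open>\<phi>\<close> over \<open>V\<close>, that is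
  a section of \<open>G\<close> over \<open>U\<close>, is literally a section of the direct image of \<open>G\<close> under
  \<open>open_nbhds X\<close> over \<open>Filt_basic X U\<close>. The comparison map sends it to its class
  in the inverse image presheaf and then into the sheafification.\<close>

lemma preimage_in_Filt_basic:
  assumes "openin X U"
  shows "preimage_in X (open_nbhds X) (Filt_basic X U) = U"
proof -
  have "open_nbhds X x \<in> Filt_basic X U \<longleftrightarrow> x \<in> U" if "x \<in> topspace X" for x
  proof -
    have "open_nbhds X x \<in> Filt_basic X U \<longleftrightarrow> U \<in> open_nbhds X x"
      by (simp add: Filt_basic_def topological_filter_open_nbhds[OF that])
    also have "\<dots> \<longleftrightarrow> x \<in> U"
      by (simp add: open_nbhds_def assms)
    finally show ?thesis .
  qed
  then have "preimage_in X (open_nbhds X) (Filt_basic X U) = {x \<in> topspace X. x \<in> U}"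
    by (simp add: preimage_in_def cong: conj_cong)
  also have "\<dots> = U"
    using openin_subset[OF assms] by auto
  finally show ?thesis .
qed

lemma Filt_basic_in_open_nbhds_image:
  assumes "continuous_map X Y \<phi>" "openin Y V"
  shows "Filt_basic X (preimage_in X \<phi> V) \<in>
    open_nbhds_image (Filt X) (filter_of_map X Y \<phi>) V"
proof -
  have pre: "openin X (preimage_in X \<phi> V)"
    by (rule openin_preimage_in[OF assms])
  have "filter_of_map X Y \<phi> y \<in> Filt_basic X (preimage_in X \<phi> V)" if "y \<in> V" for y
  proof -
    have y: "y \<in> topspace Y" using that openin_subset[OF assms(2)] by blast
    have "preimage_in X \<phi> V \<in> filter_of_map X Y \<phi> y"
      using pre assms(2) that by (auto simp: filter_of_map_eq[OF assms(1) y])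
    then show ?thesis
      by (simp add: Filt_basic_def topological_filter_of_map[OF assms(1)])
  qed
  then show ?thesis
    using openin_Filt_basic[OF pre] by (auto simp: open_nbhds_image_def)
qed

definition canonical_comparison ::
    "'a topology \<Rightarrow> 'b topology \<Rightarrow> ('a \<Rightarrow> 'b) \<Rightarrow> ('a, 'g) presheaf \<Rightarrow>
      'b set \<Rightarrow> 'g \<Rightarrow> 'b \<Rightarrow> ('b set \<times> ('a set set set \<times> 'g) set) set" where
  "canonical_comparison X Y \<phi> G V s =
    (let H = direct_image X (open_nbhds X) G; \<psi> = filter_of_map X Y \<phi> in
      stalk_germs Y (inverse_image_presheaf (Filt X) \<psi> H) V
        (germ H (open_nbhds_image (Filt X) \<psi> V) (Filt_basic X (preimage_in X \<phi> V)) s))"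

end

theory Submission
  imports Defs
begin

text \<open>
  The neighbourhoods of a filter \<open>\<psi> y = filter_of_map X Y \<phi> y\<close> in \<open>Filt X\<close> have as a base the sets
  \<open>Filt_basic X (preimage_in X \<phi> V)\<close>, \<open>V\<close> an open neighbourhood of \<open>y\<close> (\<open>filter_of_map_nbhd_base\<close>).
  The sections over such a set of the direct image \<open>H\<close> of \<open>G\<close> under \<open>open_nbhds X\<close> are literally
  the sections of \<open>G\<close> over \<open>preimage_in X \<phi> V\<close>, that is, those of the direct image of \<open>G\<close> under
  \<open>\<phi>\<close> over \<open>V\<close>. Hence \<open>direct_image X \<phi> G\<close> maps to the presheaf \<open>V \<mapsto> colim H W\<close>
  (\<open>W\<close> running over the open sets containing \<open>\<psi> ` V\<close>), and this map is locally injective and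
  locally surjective: an equation between germs, or a representative of a germ, that lives on some
  \<open>W\<close> restricts near \<open>y\<close> to a basic set contained in \<open>W\<close>.

  As \<open>direct_image X \<phi> G\<close> is already a sheaf (\<open>ab_sheaf_direct_image\<close>), a locally bijective
  morphism from it to a presheaf becomes an isomorphism after sheafification of the target
  (\<open>sheafification_isomorphism\<close>). The sheaf and group axioms of the target are carried over along
  the bijections on sections (\<open>sheaf_isomorphism_bijective\<close>). The group
  operations on direct limits are computed on representatives by \<open>germ_mult\<close>; this is used twice, for the presheaf above and for its stalks.
\<close>

section \<open>Direct limits of sections\<close>

lemma (in ab_presheaf) Res_closed:
  "\<lbrakk>openin X U; openin X V; V \<subseteq> U; s \<in> carrier (Sec F U)\<rbrakk> \<Longrightarrow> Res F U V s \<in> carrier (Sec F V)"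
  by (rule hom_in_carrier[OF Res_hom])

lemma (in ab_presheaf) Res_mult:
  "\<lbrakk>openin X U; openin X V; V \<subseteq> U; s \<in> carrier (Sec F U); t \<in> carrier (Sec F U)\<rbrakk>
    \<Longrightarrow> Res F U V (s \<otimes>\<^bsub>Sec F U\<^esub> t) = Res F U V s \<otimes>\<^bsub>Sec F V\<^esub> Res F U V t"
  by (rule hom_mult[OF Res_hom])

lemma (in ab_presheaf) Res_one:
  assumes "openin X U" "openin X V" "V \<subseteq> U"
  shows "Res F U V \<one>\<^bsub>Sec F U\<^esub> = \<one>\<^bsub>Sec F V\<^esub>"
  using Res_hom[OF assms] Sec_group[OF assms(1)] Sec_group[OF assms(2)]
  by (intro hom_one) (auto simp: comm_group_def)

locale presheaf_colimit = ab_presheaf X F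
  for X :: "'a topology" and F :: "('a, 'g) presheaf" +
  fixes I :: "'a set set"
  assumes index_open: "U \<in> I \<Longrightarrow> openin X U"
    and index_nonempty: "I \<noteq> {}"
    and index_Int: "\<lbrakk>U \<in> I; V \<in> I\<rbrakk> \<Longrightarrow> U \<inter> V \<in> I"
begin

text \<open>Transitivity holds because two equations, valid over \<open>W\<close> and over \<open>W'\<close>, can be combined over
  \<open>W \<inter> W'\<close>, which is again in the index set.\<close>

lemma equiv_germ_rel: "equiv (SIGMA U:I. carrier (Sec F U)) (germ_rel F I)"
proof (rule equivI)
  show "germ_rel F I \<subseteq> (SIGMA U:I. carrier (Sec F U)) \<times> (SIGMA U:I. carrier (Sec F U))"
    by (auto simp: germ_rel_def)
  show "refl_on (SIGMA U:I. carrier (Sec F U)) (germ_rel F I)"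
    using index_Int by (auto simp: refl_on_def germ_rel_def)
  show "sym (germ_rel F I)"
    unfolding sym_def germ_rel_def by (auto simp: Int_commute intro: sym)
  show "trans (germ_rel F I)"
  proof (rule transI)
    fix a b c assume "(a, b) \<in> germ_rel F I" "(b, c) \<in> germ_rel F I"
    then obtain U s V t T r W W' where
      abc: "a = (U, s)" "b = (V, t)" "c = (T, r)" and I: "U \<in> I" "V \<in> I" "T \<in> I" "W \<in> I" "W' \<in> I"
      and s: "s \<in> carrier (Sec F U)" "t \<in> carrier (Sec F V)" "r \<in> carrier (Sec F T)"
      and W: "W \<subseteq> U" "W \<subseteq> V" "Res F U W s = Res F V W t"
      and W': "W' \<subseteq> V" "W' \<subseteq> T" "Res F V W' t = Res F T W' r"
      unfolding germ_rel_def by auto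
    note op = I[THEN index_open]
    have oW: "openin X (W \<inter> W')" using op by blast
    have "Res F U (W \<inter> W') s = Res F W (W \<inter> W') (Res F U W s)"
      by (rule Res_Res[OF op(1) op(4) oW Int_lower1 W(1) s(1), symmetric])
    also have "\<dots> = Res F V (W \<inter> W') t"
      using Res_Res[OF op(2) op(4) oW Int_lower1 W(2) s(2)] W(3) by simp
    also have "\<dots> = Res F W' (W \<inter> W') (Res F V W' t)"
      by (rule Res_Res[OF op(2) op(5) oW Int_lower2 W'(1) s(2), symmetric])
    also have "\<dots> = Res F T (W \<inter> W') r"
      using Res_Res[OF op(3) op(5) oW Int_lower2 W'(2) s(3)] W'(3) by simp
    finally show "(a, c) \<in> germ_rel F I"
      using abc I s W W' index_Int[of W W'] unfolding germ_rel_def by blast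
  qed
qed

lemma germ_eq_iff:
  assumes "U \<in> I" "V \<in> I" "s \<in> carrier (Sec F U)" "t \<in> carrier (Sec F V)"
  shows "germ F I U s = germ F I V t \<longleftrightarrow> (\<exists>W\<in>I. W \<subseteq> U \<inter> V \<and> Res F U W s = Res F V W t)"
proof -
  have "germ F I U s = germ F I V t \<longleftrightarrow> ((U, s), (V, t)) \<in> germ_rel F I"
    unfolding germ_def using assms by (intro eq_equiv_class_iff[OF equiv_germ_rel]) auto
  then show ?thesis using assms by (simp add: germ_rel_def)
qed

lemma germ_eqI:
  assumes "U \<in> I" "V \<in> I" "s \<in> carrier (Sec F U)" "t \<in> carrier (Sec F V)"
    and "W \<in> I" "W \<subseteq> U" "W \<subseteq> V" "Res F U W s = Res F V W t"
  shows "germ F I U s = germ F I V t"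
  using germ_eq_iff[OF assms(1-4)] assms(5-8) by blast

lemma mem_germ_iff:
  assumes "U \<in> I" "s \<in> carrier (Sec F U)"
  shows "(V, t) \<in> germ F I U s \<longleftrightarrow>
    V \<in> I \<and> t \<in> carrier (Sec F V) \<and> germ F I V t = germ F I U s"
proof -
  have "(V, t) \<in> germ F I U s \<longleftrightarrow> ((U, s), (V, t)) \<in> germ_rel F I"
    by (simp add: germ_def)
  also have "\<dots> \<longleftrightarrow> V \<in> I \<and> t \<in> carrier (Sec F V) \<and> germ F I U s = germ F I V t"
    using assms germ_eq_iff[of U V s t] by (auto simp: germ_rel_def)
  finally show ?thesis by metis
qed

lemma germ_closed:
  "\<lbrakk>U \<in> I; s \<in> carrier (Sec F U)\<rbrakk> \<Longrightarrow> germ F I U s \<in> carrier (direct_limit F I)"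
  by (auto simp: direct_limit_def germ_def intro: quotientI)

lemma direct_limit_cases:
  assumes "A \<in> carrier (direct_limit F I)"
  obtains U s where "U \<in> I" "s \<in> carrier (Sec F U)" "A = germ F I U s"
  using assms by (auto simp: direct_limit_def germ_def quotient_def)

lemma germ_Res:
  assumes "U \<in> I" "V \<in> I" "V \<subseteq> U" "s \<in> carrier (Sec F U)"
  shows "germ F I V (Res F U V s) = germ F I U s"
proof -
  note op = index_open[OF assms(1)] index_open[OF assms(2)]
  have closed: "Res F U V s \<in> carrier (Sec F V)" using Res_closed[OF op assms(3,4)] .
  show ?thesis
    using germ_eqI[OF assms(2,1) closed assms(4,2) order_refl assms(3)] Res_id[OF op(2) closed]
    by simp
qed

text \<open>Any finite number of germs have representatives over one common member of the index set, so
  identities between group operations can be checked on sections. Three suffice for associativity.\<close>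

lemma direct_limit_cases3:
  assumes "A \<in> carrier (direct_limit F I)" "B \<in> carrier (direct_limit F I)"
    "C \<in> carrier (direct_limit F I)"
  obtains U a b c where "U \<in> I"
    "a \<in> carrier (Sec F U)" "b \<in> carrier (Sec F U)" "c \<in> carrier (Sec F U)"
    "A = germ F I U a" "B = germ F I U b" "C = germ F I U c"
proof -
  obtain U1 a where A: "U1 \<in> I" "a \<in> carrier (Sec F U1)" "A = germ F I U1 a"
    using assms(1) by (rule direct_limit_cases)
  obtain U2 b where B: "U2 \<in> I" "b \<in> carrier (Sec F U2)" "B = germ F I U2 b"
    using assms(2) by (rule direct_limit_cases)
  obtain U3 c where C: "U3 \<in> I" "c \<in> carrier (Sec F U3)" "C = germ F I U3 c"
    using assms(3) by (rule direct_limit_cases)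
  define U where "U = U1 \<inter> U2 \<inter> U3"
  have U: "U \<in> I" "U \<subseteq> U1" "U \<subseteq> U2" "U \<subseteq> U3"
    using A B C index_Int by (auto simp: U_def)
  show ?thesis
  proof (rule that)
    show "A = germ F I U (Res F U1 U a)" "B = germ F I U (Res F U2 U b)"
      "C = germ F I U (Res F U3 U c)"
      using A B C U germ_Res by auto
  qed (use A B C U index_open Res_closed in auto)
qed

text \<open>The product is defined as a union over all pairs of representatives; it is the class of a
  single product because restrictions are homomorphisms, so all these pairs give the same class.\<close>

lemma germ_mult:
  assumes U: "U \<in> I" "s \<in> carrier (Sec F U)" "t \<in> carrier (Sec F U)"
  shows "germ F I U s \<otimes>\<^bsub>direct_limit F I\<^esub> germ F I U t = germ F I U (s \<otimes>\<^bsub>Sec F U\<^esub> t)"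
proof -
  have closed: "a \<otimes>\<^bsub>Sec F V\<^esub> b \<in> carrier (Sec F V)"
    if "V \<in> I" "a \<in> carrier (Sec F V)" "b \<in> carrier (Sec F V)" for V a b
    using comm_group.axioms(2)[OF Sec_group[OF index_open[OF that(1)]]] that(2,3)
    by (intro monoid.m_closed group.is_monoid)
  have same: "germ F I V (a \<otimes>\<^bsub>Sec F V\<^esub> b) = germ F I U (s \<otimes>\<^bsub>Sec F U\<^esub> t)"
    if ab: "(V, a) \<in> germ F I U s" "(V, b) \<in> germ F I U t" for V a b
  proof -
    have V: "V \<in> I" "a \<in> carrier (Sec F V)" "b \<in> carrier (Sec F V)"
      and eq: "germ F I V a = germ F I U s" "germ F I V b = germ F I U t"
      using ab U mem_germ_iff by auto
    obtain W where W: "W \<in> I" "W \<subseteq> V \<inter> U" "Res F V W a = Res F U W s"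
      using eq(1) V U germ_eq_iff by meson
    obtain W' where W': "W' \<in> I" "W' \<subseteq> V \<inter> U" "Res F V W' b = Res F U W' t"
      using eq(2) V U germ_eq_iff by meson
    note op = index_open[OF U(1)] index_open[OF V(1)] index_open[OF W(1)] index_open[OF W'(1)]
    have oW: "openin X (W \<inter> W')" using op by blast
    have sub: "W \<subseteq> V" "W \<subseteq> U" "W' \<subseteq> V" "W' \<subseteq> U" "W \<inter> W' \<subseteq> V" "W \<inter> W' \<subseteq> U"
      using W W' by auto
    have a: "Res F V (W \<inter> W') a = Res F U (W \<inter> W') s"
      using Res_Res[OF op(2) op(3) oW Int_lower1 sub(1) V(2)]
        Res_Res[OF op(1) op(3) oW Int_lower1 sub(2) U(2)] W(3) by simp
    have b: "Res F V (W \<inter> W') b = Res F U (W \<inter> W') t"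
      using Res_Res[OF op(2) op(4) oW Int_lower2 sub(3) V(3)]
        Res_Res[OF op(1) op(4) oW Int_lower2 sub(4) U(3)] W'(3) by simp
    have "Res F V (W \<inter> W') (a \<otimes>\<^bsub>Sec F V\<^esub> b) = Res F U (W \<inter> W') (s \<otimes>\<^bsub>Sec F U\<^esub> t)"
      using Res_mult[OF op(2) oW sub(5) V(2,3)] Res_mult[OF op(1) oW sub(6) U(2,3)] a b by simp
    then show ?thesis
      by (rule germ_eqI[OF V(1) U(1) closed[OF V] closed[OF U] index_Int[OF W(1) W'(1)] sub(5,6)])
  qed
  have "{germ F I V (a \<otimes>\<^bsub>Sec F V\<^esub> b) |V a b. (V, a) \<in> germ F I U s \<and> (V, b) \<in> germ F I U t}
      = {germ F I U (s \<otimes>\<^bsub>Sec F U\<^esub> t)}" (is "?L = _")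
  proof
    show "?L \<subseteq> {germ F I U (s \<otimes>\<^bsub>Sec F U\<^esub> t)}" using same by blast
    have "(U, s) \<in> germ F I U s" "(U, t) \<in> germ F I U t" using U mem_germ_iff by auto
    then show "{germ F I U (s \<otimes>\<^bsub>Sec F U\<^esub> t)} \<subseteq> ?L" by blast
  qed
  then show ?thesis by (simp add: direct_limit_def)
qed

lemma Sec_one_closed: "U \<in> I \<Longrightarrow> \<one>\<^bsub>Sec F U\<^esub> \<in> carrier (Sec F U)"
  using comm_group.axioms(2)[OF Sec_group[OF index_open]] by (intro monoid.one_closed group.is_monoid)

lemma germ_one:
  assumes "U \<in> I"
  shows "germ F I U \<one>\<^bsub>Sec F U\<^esub> = \<one>\<^bsub>direct_limit F I\<^esub>"
proof -
  have "germ F I V \<one>\<^bsub>Sec F V\<^esub> = germ F I U \<one>\<^bsub>Sec F U\<^esub>" if "V \<in> I" for V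
  proof -
    have VU: "V \<inter> U \<in> I" using index_Int that assms .
    have "germ F I V \<one>\<^bsub>Sec F V\<^esub> = germ F I (V \<inter> U) \<one>\<^bsub>Sec F (V \<inter> U)\<^esub>"
      using germ_Res[OF that VU Int_lower1 Sec_one_closed[OF that]]
        Res_one[OF index_open[OF that] index_open[OF VU] Int_lower1] by simp
    also have "\<dots> = germ F I U \<one>\<^bsub>Sec F U\<^esub>"
      using germ_Res[OF assms VU Int_lower2 Sec_one_closed[OF assms]]
        Res_one[OF index_open[OF assms] index_open[OF VU] Int_lower2] by simp
    finally show ?thesis .
  qed
  then have "(\<Union>V\<in>I. germ F I V \<one>\<^bsub>Sec F V\<^esub>) = germ F I U \<one>\<^bsub>Sec F U\<^esub>"
    by (rule SUP_eq_const[OF index_nonempty])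
  then show ?thesis by (simp add: direct_limit_def)
qed

theorem direct_limit_comm_group: "comm_group (direct_limit F I)"
proof (rule comm_groupI)
  fix A B C
  assume ABC: "A \<in> carrier (direct_limit F I)" "B \<in> carrier (direct_limit F I)"
    "C \<in> carrier (direct_limit F I)"
  obtain U a b c where U: "U \<in> I"
    "a \<in> carrier (Sec F U)" "b \<in> carrier (Sec F U)" "c \<in> carrier (Sec F U)"
    "A = germ F I U a" "B = germ F I U b" "C = germ F I U c"
    using ABC by (rule direct_limit_cases3)
  interpret S: comm_group "Sec F U" using Sec_group index_open U(1) .
  show "A \<otimes>\<^bsub>direct_limit F I\<^esub> B \<otimes>\<^bsub>direct_limit F I\<^esub> C =
      A \<otimes>\<^bsub>direct_limit F I\<^esub> (B \<otimes>\<^bsub>direct_limit F I\<^esub> C)"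
    using U by (simp add: germ_mult S.m_assoc)
next
  fix A B
  assume AB: "A \<in> carrier (direct_limit F I)" "B \<in> carrier (direct_limit F I)"
  obtain U a b where U: "U \<in> I" "a \<in> carrier (Sec F U)" "b \<in> carrier (Sec F U)"
    "A = germ F I U a" "B = germ F I U b"
    using AB AB(2) by (rule direct_limit_cases3)
  interpret S: comm_group "Sec F U" using Sec_group index_open U(1) .
  show "A \<otimes>\<^bsub>direct_limit F I\<^esub> B \<in> carrier (direct_limit F I)"
    using U by (simp add: germ_mult germ_closed)
  show "A \<otimes>\<^bsub>direct_limit F I\<^esub> B = B \<otimes>\<^bsub>direct_limit F I\<^esub> A"
    using U by (simp add: germ_mult S.m_comm)
next
  obtain U where "U \<in> I" using index_nonempty by blast
  then show "\<one>\<^bsub>direct_limit F I\<^esub> \<in> carrier (direct_limit F I)"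
    using germ_closed Sec_one_closed germ_one by metis
next
  fix A assume "A \<in> carrier (direct_limit F I)"
  then obtain U a where U: "U \<in> I" "a \<in> carrier (Sec F U)" "A = germ F I U a"
    by (rule direct_limit_cases)
  interpret S: comm_group "Sec F U" using Sec_group index_open U(1) .
  show "\<one>\<^bsub>direct_limit F I\<^esub> \<otimes>\<^bsub>direct_limit F I\<^esub> A = A"
    using U by (simp add: germ_mult flip: germ_one[OF U(1)])
  show "\<exists>B\<in>carrier (direct_limit F I). B \<otimes>\<^bsub>direct_limit F I\<^esub> A = \<one>\<^bsub>direct_limit F I\<^esub>"
    using U by (intro bexI[of _ "germ F I U (inv\<^bsub>Sec F U\<^esub> a)"])
      (simp_all add: germ_mult germ_closed flip: germ_one[OF U(1)])
qed

end

lemma (in ab_presheaf) stalk_colimit: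
  "x \<in> topspace X \<Longrightarrow> presheaf_colimit X F (open_nbhds X x)"
  by unfold_locales (auto simp: open_nbhds_def)


section \<open>Direct and inverse images\<close>

lemma preimage_in_mono: "V \<subseteq> W \<Longrightarrow> preimage_in X f V \<subseteq> preimage_in X f W"
  by (auto simp: preimage_in_def)

lemma ab_presheaf_direct_image:
  assumes "ab_presheaf X F" "continuous_map X Y f"
  shows "ab_presheaf Y (direct_image X f F)"
proof -
  interpret ab_presheaf X F by fact
  show ?thesis
    by (rule ab_presheaf.intro)
      (simp_all add: direct_image_def openin_preimage_in[OF assms(2)] preimage_in_mono
        Sec_group Res_hom Res_id Res_Res)
qed

lemma ab_sheaf_direct_image:
  assumes "ab_sheaf X F" "continuous_map X Y f"
  shows "ab_sheaf Y (direct_image X f F)"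
proof -
  interpret ab_sheaf X F by fact
  interpret D: ab_presheaf Y "direct_image X f F"
    by (rule ab_presheaf_direct_image[OF ab_presheaf_axioms assms(2)])
  let ?p = "preimage_in X f"
  have Un: "?p (\<Union>C) = \<Union>(?p ` C)" for C by (auto simp: preimage_in_def)
  have Int: "?p (U \<inter> V) = ?p U \<inter> ?p V" for U V by (auto simp: preimage_in_def)
  show ?thesis
  proof (rule ab_sheaf.intro[OF D.ab_presheaf_axioms ab_sheaf_axioms.intro])
    fix C s t
    assume op: "\<And>U. U \<in> C \<Longrightarrow> openin Y U"
      and st: "s \<in> carrier (Sec (direct_image X f F) (\<Union>C))"
        "t \<in> carrier (Sec (direct_image X f F) (\<Union>C))"
        "\<And>U. U \<in> C \<Longrightarrow> Res (direct_image X f F) (\<Union>C) U s = Res (direct_image X f F) (\<Union>C) U t"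
    show "s = t"
    proof (rule locality)
      show "\<And>U. U \<in> ?p ` C \<Longrightarrow> openin X U" using op openin_preimage_in[OF assms(2)] by auto
    qed (use st in \<open>auto simp: direct_image_def Un\<close>)
  next
    fix C g
    assume op: "\<And>U. U \<in> C \<Longrightarrow> openin Y U"
      and g: "\<And>U. U \<in> C \<Longrightarrow> g U \<in> carrier (Sec (direct_image X f F) U)"
      and comp: "\<And>U V. \<lbrakk>U \<in> C; V \<in> C\<rbrakk> \<Longrightarrow>
        Res (direct_image X f F) U (U \<inter> V) (g U) = Res (direct_image X f F) V (U \<inter> V) (g V)"
    have op': "openin X (?p U)" if "U \<in> C" for U using op openin_preimage_in[OF assms(2)] that by blast
    have comp': "Res F (?p U) (?p U \<inter> ?p V) (g U) = Res F (?p V) (?p U \<inter> ?p V) (g V)"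
      if "U \<in> C" "V \<in> C" for U V
      using comp[OF that] by (simp add: direct_image_def Int)
    have g': "g U \<in> carrier (Sec F (?p U))" if "U \<in> C" for U
      using g[OF that] by (simp add: direct_image_def)
    define c where "c = inv_into C ?p"
    have c: "c W \<in> C" "?p (c W) = W" if "W \<in> ?p ` C" for W
      using that by (auto simp: c_def inv_into_into f_inv_into_f)
    \<comment> \<open>distinct members of the cover may have the same preimage; compatibility then forces
      the sections over them to agree\<close>
    have gc: "g (c (?p U)) = g U" if "U \<in> C" for U
    proof -
      have c': "c (?p U) \<in> C" "?p (c (?p U)) = ?p U" using c that by auto
      have "Res F (?p U) (?p U) (g (c (?p U))) = Res F (?p U) (?p U) (g U)"
        using comp'[OF c'(1) that] c' by simp
      then show ?thesis using Res_id op'[OF that] g'[OF that] g'[OF c'(1)] c' by simp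
    qed
    have "\<exists>s\<in>carrier (Sec F (\<Union>(?p ` C))). \<forall>W\<in>?p ` C. Res F (\<Union>(?p ` C)) W s = g (c W)"
    proof (rule gluing)
      show "g (c W) \<in> carrier (Sec F W)" if "W \<in> ?p ` C" for W
        using g' c that by metis
      show "Res F W (W \<inter> W') (g (c W)) = Res F W' (W \<inter> W') (g (c W'))"
        if "W \<in> ?p ` C" "W' \<in> ?p ` C" for W W'
        using comp'[of "c W" "c W'"] c that by simp
    qed (use op' in auto)
    then show "\<exists>s\<in>carrier (Sec (direct_image X f F) (\<Union>C)).
        \<forall>U\<in>C. Res (direct_image X f F) (\<Union>C) U s = g U"
      by (simp add: direct_image_def Un gc)
  qed
qed

lemma (in ab_presheaf) image_colimit:
  assumes "f ` V \<subseteq> topspace X"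
  shows "presheaf_colimit X F (open_nbhds_image X f V)"
  using assms by unfold_locales (auto simp: open_nbhds_image_def)

text \<open>The restriction is defined as a union over all representatives of a class; a larger index set
  identifies more sections, so all of them give the same class.\<close>

lemma (in ab_presheaf) inverse_image_presheaf_Res_germ:
  assumes f: "f ` V \<subseteq> topspace X" and V': "V' \<subseteq> V"
    and W: "W \<in> open_nbhds_image X f V" "s \<in> carrier (Sec F W)"
  shows "Res (inverse_image_presheaf X f F) V V' (germ F (open_nbhds_image X f V) W s) =
    germ F (open_nbhds_image X f V') W s"
proof -
  interpret A: presheaf_colimit X F "open_nbhds_image X f V" by (rule image_colimit[OF f])
  interpret B: presheaf_colimit X F "open_nbhds_image X f V'"
    using f V' by (intro image_colimit) auto
  have sub: "open_nbhds_image X f V \<subseteq> open_nbhds_image X f V'"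
    using V' by (auto simp: open_nbhds_image_def)
  have same: "germ F (open_nbhds_image X f V') T t = germ F (open_nbhds_image X f V') W s"
    if "(T, t) \<in> germ F (open_nbhds_image X f V) W s" for T t
  proof -
    have T: "T \<in> open_nbhds_image X f V" "t \<in> carrier (Sec F T)"
      "germ F (open_nbhds_image X f V) T t = germ F (open_nbhds_image X f V) W s"
      using A.mem_germ_iff[OF W] that by auto
    then obtain N where N: "N \<in> open_nbhds_image X f V" "N \<subseteq> T \<inter> W" "Res F T N t = Res F W N s"
      using A.germ_eq_iff W by meson
    show ?thesis
      by (rule B.germ_eqI[of T W t s N]) (use T W N sub in auto)
  qed
  have "(\<Union>(T, t)\<in>germ F (open_nbhds_image X f V) W s. germ F (open_nbhds_image X f V') T t) =
      germ F (open_nbhds_image X f V') W s"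
  proof (rule SUP_eq_const)
    show "germ F (open_nbhds_image X f V) W s \<noteq> {}"
      using A.mem_germ_iff[OF W] W by blast
    show "(case x of (T, t) \<Rightarrow> germ F (open_nbhds_image X f V') T t) =
        germ F (open_nbhds_image X f V') W s" if "x \<in> germ F (open_nbhds_image X f V) W s" for x
      using same[of "fst x" "snd x"] that by (simp add: case_prod_unfold)
  qed
  then show ?thesis by (simp add: inverse_image_presheaf_def)
qed

lemma ab_presheaf_inverse_image_presheaf:
  assumes "ab_presheaf Z H" "continuous_map Y Z f"
  shows "ab_presheaf Y (inverse_image_presheaf Z f H)"
proof -
  interpret ab_presheaf Z H by fact
  let ?P = "inverse_image_presheaf Z f H" and ?I = "open_nbhds_image Z f"
  have f: "f ` V \<subseteq> topspace Z" if "openin Y V" for V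
    using assms(2) openin_subset[OF that] by (auto simp: continuous_map_def)
  have col: "presheaf_colimit Z H (?I V)" if "openin Y V" for V
    using image_colimit[OF f[OF that]] .
  have mono: "?I V \<subseteq> ?I V'" if "V' \<subseteq> V" for V V'
    using that by (auto simp: open_nbhds_image_def)
  have Sec: "Sec ?P V = direct_limit H (?I V)" for V by (simp add: inverse_image_presheaf_def)
  show ?thesis
  proof (rule ab_presheaf.intro)
    fix V assume V: "openin Y V"
    show "comm_group (Sec ?P V)"
      using presheaf_colimit.direct_limit_comm_group[OF col[OF V]] by (simp add: Sec)
  next
    fix V V' assume V: "openin Y V" "openin Y V'" "V' \<subseteq> V"
    interpret A: presheaf_colimit Z H "?I V" by (rule col[OF V(1)])
    interpret B: presheaf_colimit Z H "?I V'" by (rule col[OF V(2)])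
    note R = inverse_image_presheaf_Res_germ[OF f[OF V(1)] V(3)]
    show "Res ?P V V' \<in> hom (Sec ?P V) (Sec ?P V')"
    proof (rule homI)
      fix a assume "a \<in> carrier (Sec ?P V)"
      then obtain W s where "W \<in> ?I V" "s \<in> carrier (Sec H W)" "a = germ H (?I V) W s"
        unfolding Sec by (rule A.direct_limit_cases)
      then show "Res ?P V V' a \<in> carrier (Sec ?P V')"
        using B.germ_closed mono[OF V(3)] R by (auto simp: Sec)
    next
      fix a b assume ab: "a \<in> carrier (Sec ?P V)" "b \<in> carrier (Sec ?P V)"
      obtain W s t where W: "W \<in> ?I V" "s \<in> carrier (Sec H W)" "t \<in> carrier (Sec H W)"
        and a: "a = germ H (?I V) W s" "b = germ H (?I V) W t"
        using ab ab(2) unfolding Sec by (rule A.direct_limit_cases3)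
      interpret S: comm_group "Sec H W" using Sec_group A.index_open W(1) .
      have "W \<in> ?I V'" using W mono[OF V(3)] by auto
      then show "Res ?P V V' (a \<otimes>\<^bsub>Sec ?P V\<^esub> b) = Res ?P V V' a \<otimes>\<^bsub>Sec ?P V'\<^esub> Res ?P V V' b"
        using W by (simp add: a Sec A.germ_mult B.germ_mult R)
    qed
  next
    fix V a assume V: "openin Y V" "a \<in> carrier (Sec ?P V)"
    then show "Res ?P V V a = a"
      using inverse_image_presheaf_Res_germ[OF f[OF V(1)] order_refl] unfolding Sec
      by (metis presheaf_colimit.direct_limit_cases[OF col[OF V(1)]])
  next
    fix V V' V'' a
    assume V: "openin Y V" "openin Y V'" "openin Y V''" "V'' \<subseteq> V'" "V' \<subseteq> V"
      and a: "a \<in> carrier (Sec ?P V)"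
    obtain W s where W: "W \<in> ?I V" "s \<in> carrier (Sec H W)" "a = germ H (?I V) W s"
      using a unfolding Sec by (rule presheaf_colimit.direct_limit_cases[OF col[OF V(1)]])
    have W': "W \<in> ?I V'" using W mono[OF V(5)] by auto
    have "V'' \<subseteq> V" using V(4,5) by auto
    then show "Res ?P V' V'' (Res ?P V V' a) = Res ?P V V'' a"
      using inverse_image_presheaf_Res_germ[OF f[OF V(1)] _ W(1,2)]
        inverse_image_presheaf_Res_germ[OF f[OF V(2)] V(4) W' W(2)] V(5) by (simp add: W(3))
  qed
qed


section \<open>Bijective morphisms out of a sheaf\<close>

text \<open>The target inherits the group axioms and the sheaf axioms through the bijections; its unit
  has to be matched by hand, as a homomorphism is only required to respect products.\<close>

lemma sheaf_isomorphism_bijective: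
  assumes F: "ab_sheaf X F" and mor: "presheaf_morphism X F G \<alpha>"
    and bij: "\<And>U. openin X U \<Longrightarrow> bij_betw (\<alpha> U) (carrier (Sec F U)) (carrier (Sec G U))"
    and one: "\<And>U. openin X U \<Longrightarrow> \<alpha> U \<one>\<^bsub>Sec F U\<^esub> = \<one>\<^bsub>Sec G U\<^esub>"
  shows "sheaf_isomorphism X F G \<alpha>"
proof -
  interpret F: ab_sheaf X F by fact
  define \<beta> where "\<beta> U = inv_into (carrier (Sec F U)) (\<alpha> U)" for U
  have \<alpha>_hom: "\<alpha> U \<in> hom (Sec F U) (Sec G U)" if "openin X U" for U
    using mor that by (simp add: presheaf_morphism_def)
  have \<alpha>_Res: "\<alpha> V (Res F U V s) = Res G U V (\<alpha> U s)"
    if "openin X U" "openin X V" "V \<subseteq> U" "s \<in> carrier (Sec F U)" for U V s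
    using mor that by (simp add: presheaf_morphism_def)
  have \<alpha>_closed: "\<alpha> U s \<in> carrier (Sec G U)" if "openin X U" "s \<in> carrier (Sec F U)" for U s
    using \<alpha>_hom hom_in_carrier that by metis
  have \<beta>_closed: "\<beta> U t \<in> carrier (Sec F U)" if "openin X U" "t \<in> carrier (Sec G U)" for U t
    using bij[OF that(1)] that(2) by (simp add: \<beta>_def bij_betw_def inv_into_into)
  have \<beta>\<alpha>: "\<beta> U (\<alpha> U s) = s" if "openin X U" "s \<in> carrier (Sec F U)" for U s
    using bij_betw_inv_into_left[OF bij[OF that(1)] that(2)] by (simp add: \<beta>_def)
  have \<alpha>\<beta>: "\<alpha> U (\<beta> U t) = t" if "openin X U" "t \<in> carrier (Sec G U)" for U t
    using bij_betw_inv_into_right[OF bij[OF that(1)] that(2)] by (simp add: \<beta>_def)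
  have \<beta>_mult: "\<beta> U (s \<otimes>\<^bsub>Sec G U\<^esub> t) = \<beta> U s \<otimes>\<^bsub>Sec F U\<^esub> \<beta> U t"
    and G_closed: "s \<otimes>\<^bsub>Sec G U\<^esub> t \<in> carrier (Sec G U)"
    if U: "openin X U" and s: "s \<in> carrier (Sec G U)" and t: "t \<in> carrier (Sec G U)" for U s t
  proof -
    interpret S: comm_group "Sec F U" using F.Sec_group U .
    have "s \<otimes>\<^bsub>Sec G U\<^esub> t = \<alpha> U (\<beta> U s \<otimes>\<^bsub>Sec F U\<^esub> \<beta> U t)"
      using hom_mult[OF \<alpha>_hom[OF U] \<beta>_closed[OF U s] \<beta>_closed[OF U t]] \<alpha>\<beta> U s t by simp
    then show "\<beta> U (s \<otimes>\<^bsub>Sec G U\<^esub> t) = \<beta> U s \<otimes>\<^bsub>Sec F U\<^esub> \<beta> U t"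
      "s \<otimes>\<^bsub>Sec G U\<^esub> t \<in> carrier (Sec G U)"
      using \<beta>\<alpha> \<alpha>_closed \<beta>_closed U s t by simp_all
  qed
  have G_eqI: "s = t" if "openin X U" "s \<in> carrier (Sec G U)" "t \<in> carrier (Sec G U)" "\<beta> U s = \<beta> U t"
    for U s t using \<alpha>\<beta> that by metis
  have G_group: "comm_group (Sec G U)" if U: "openin X U" for U
  proof -
    interpret S: comm_group "Sec F U" using F.Sec_group U .
    have one_closed: "\<one>\<^bsub>Sec G U\<^esub> \<in> carrier (Sec G U)"
      using \<alpha>_closed[OF U S.one_closed] one[OF U] by simp
    have \<beta>_one: "\<beta> U \<one>\<^bsub>Sec G U\<^esub> = \<one>\<^bsub>Sec F U\<^esub>"
      using \<beta>\<alpha>[OF U S.one_closed] one[OF U] by simp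
    show ?thesis
    proof (rule comm_groupI)
      fix s t r
      assume "s \<in> carrier (Sec G U)" "t \<in> carrier (Sec G U)" "r \<in> carrier (Sec G U)"
      then show "s \<otimes>\<^bsub>Sec G U\<^esub> t \<otimes>\<^bsub>Sec G U\<^esub> r = s \<otimes>\<^bsub>Sec G U\<^esub> (t \<otimes>\<^bsub>Sec G U\<^esub> r)"
        using U by (intro G_eqI[OF U]) (simp_all add: G_closed \<beta>_mult \<beta>_closed S.m_assoc)
    next
      fix s t assume "s \<in> carrier (Sec G U)" "t \<in> carrier (Sec G U)"
      then show "s \<otimes>\<^bsub>Sec G U\<^esub> t = t \<otimes>\<^bsub>Sec G U\<^esub> s"
        using U by (intro G_eqI[OF U]) (simp_all add: G_closed \<beta>_mult \<beta>_closed S.m_comm)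
    next
      fix s assume s: "s \<in> carrier (Sec G U)"
      then show "\<one>\<^bsub>Sec G U\<^esub> \<otimes>\<^bsub>Sec G U\<^esub> s = s"
        using U one_closed by (intro G_eqI[OF U]) (simp_all add: G_closed \<beta>_mult \<beta>_closed \<beta>_one)
      have "\<alpha> U (inv\<^bsub>Sec F U\<^esub> (\<beta> U s)) \<otimes>\<^bsub>Sec G U\<^esub> s = \<one>\<^bsub>Sec G U\<^esub>"
        using U s one_closed
        by (intro G_eqI[OF U]) (simp_all add: G_closed \<beta>_mult \<beta>_closed \<beta>_one \<alpha>_closed \<beta>\<alpha>)
      then show "\<exists>t\<in>carrier (Sec G U). t \<otimes>\<^bsub>Sec G U\<^esub> s = \<one>\<^bsub>Sec G U\<^esub>"
        using U s \<alpha>_closed \<beta>_closed S.inv_closed by blast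
    qed (use one_closed G_closed U in auto)
  qed
  have Res_eq: "Res G U V s = \<alpha> V (Res F U V (\<beta> U s))"
    if "openin X U" "openin X V" "V \<subseteq> U" "s \<in> carrier (Sec G U)" for U V s
    using \<alpha>_Res[OF that(1-3) \<beta>_closed[OF that(1,4)]] \<alpha>\<beta> that by simp
  have \<beta>_Res: "\<beta> V (Res G U V s) = Res F U V (\<beta> U s)"
    if "openin X U" "openin X V" "V \<subseteq> U" "s \<in> carrier (Sec G U)" for U V s
    using Res_eq[OF that] \<beta>\<alpha> F.Res_closed \<beta>_closed that by simp
  have Res_closed: "Res G U V s \<in> carrier (Sec G V)"
    if "openin X U" "openin X V" "V \<subseteq> U" "s \<in> carrier (Sec G U)" for U V s
    using Res_eq[OF that] \<alpha>_closed F.Res_closed \<beta>_closed that by simp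
  interpret G: ab_presheaf X G
  proof (rule ab_presheaf.intro)
    fix U V assume UV: "openin X U" "openin X V" "V \<subseteq> U"
    show "Res G U V \<in> hom (Sec G U) (Sec G V)"
      using UV by (intro homI Res_closed G_eqI[OF UV(2)])
        (simp_all add: Res_closed G_closed \<beta>_mult \<beta>_Res F.Res_mult \<beta>_closed)
  next
    fix U s assume "openin X U" "s \<in> carrier (Sec G U)"
    then show "Res G U U s = s"
      by (intro G_eqI[of U]) (simp_all add: Res_closed \<beta>_Res F.Res_id \<beta>_closed)
  next
    fix U V W s
    assume "openin X U" "openin X V" "openin X W" "W \<subseteq> V" "V \<subseteq> U" "s \<in> carrier (Sec G U)"
    moreover from this have "W \<subseteq> U" by auto
    ultimately show "Res G V W (Res G U V s) = Res G U W s"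
      by (intro G_eqI[of W]) (simp_all add: Res_closed \<beta>_Res F.Res_Res \<beta>_closed)
  qed (rule G_group)
  have "ab_sheaf X G"
  proof (rule ab_sheaf.intro[OF G.ab_presheaf_axioms ab_sheaf_axioms.intro])
    fix C s t
    assume op: "\<And>U. U \<in> C \<Longrightarrow> openin X U"
      and st: "s \<in> carrier (Sec G (\<Union>C))" "t \<in> carrier (Sec G (\<Union>C))"
      and eq: "\<And>U. U \<in> C \<Longrightarrow> Res G (\<Union>C) U s = Res G (\<Union>C) U t"
    have opC: "openin X (\<Union>C)" using op by blast
    have "\<beta> (\<Union>C) s = \<beta> (\<Union>C) t"
    proof (rule F.locality)
      fix U assume U: "U \<in> C"
      then have "U \<subseteq> \<Union>C" by blast
      then show "Res F (\<Union>C) U (\<beta> (\<Union>C) s) = Res F (\<Union>C) U (\<beta> (\<Union>C) t)"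
        using \<beta>_Res[OF opC op[OF U], symmetric] eq[OF U] st by simp
    qed (use op opC st \<beta>_closed in auto)
    then show "s = t" using G_eqI opC st by blast
  next
    fix C f
    assume op: "\<And>U. U \<in> C \<Longrightarrow> openin X U"
      and f: "\<And>U. U \<in> C \<Longrightarrow> f U \<in> carrier (Sec G U)"
      and comp: "\<And>U V. \<lbrakk>U \<in> C; V \<in> C\<rbrakk> \<Longrightarrow> Res G U (U \<inter> V) (f U) = Res G V (U \<inter> V) (f V)"
    have opC: "openin X (\<Union>C)" using op by blast
    have "\<exists>s\<in>carrier (Sec F (\<Union>C)). \<forall>U\<in>C. Res F (\<Union>C) U s = \<beta> U (f U)"
    proof (rule F.gluing)
      fix U V assume UV: "U \<in> C" "V \<in> C"
      show "Res F U (U \<inter> V) (\<beta> U (f U)) = Res F V (U \<inter> V) (\<beta> V (f V))"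
        using \<beta>_Res[OF op[OF UV(1)], of "U \<inter> V" "f U"] \<beta>_Res[OF op[OF UV(2)], of "U \<inter> V" "f V"]
          comp[OF UV] f UV op by (simp add: openin_Int)
    qed (use op f \<beta>_closed in auto)
    then obtain s where s: "s \<in> carrier (Sec F (\<Union>C))" "\<And>U. U \<in> C \<Longrightarrow> Res F (\<Union>C) U s = \<beta> U (f U)"
      by blast
    have "Res G (\<Union>C) U (\<alpha> (\<Union>C) s) = f U" if "U \<in> C" for U
      using \<alpha>_Res[OF opC op[OF that] Union_upper[OF that] s(1)] s(2)[OF that]
        \<alpha>\<beta>[OF op[OF that] f[OF that]] by simp
    then show "\<exists>s\<in>carrier (Sec G (\<Union>C)). \<forall>U\<in>C. Res G (\<Union>C) U s = f U"
      using \<alpha>_closed[OF opC s(1)] by blast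
  qed
  moreover have "presheaf_morphism X G F \<beta>"
    unfolding presheaf_morphism_def using \<beta>_closed \<beta>_mult \<beta>_Res by (auto intro!: homI)
  ultimately show ?thesis
    unfolding sheaf_isomorphism_def using F mor \<beta>\<alpha> \<alpha>\<beta> by blast
qed


section \<open>Sheafification of a locally isomorphic presheaf\<close>

context ab_presheaf
begin

lemma stalk_germs_Res:
  assumes "openin X U" "openin X V" "V \<subseteq> U" "s \<in> carrier (Sec F U)"
  shows "restrict (stalk_germs X F U s) V = stalk_germs X F V (Res F U V s)"
proof
  fix x
  show "restrict (stalk_germs X F U s) V x = stalk_germs X F V (Res F U V s) x"
  proof (cases "x \<in> V")
    case True
    interpret S: presheaf_colimit X F "open_nbhds X x"
      using True openin_subset[OF assms(2)] by (intro stalk_colimit) auto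
    have "U \<in> open_nbhds X x" "V \<in> open_nbhds X x"
      using True assms by (auto simp: open_nbhds_def)
    then show ?thesis
      using S.germ_Res[OF _ _ assms(3,4)] True assms(3) by (auto simp: stalk_germs_def)
  qed (simp add: stalk_germs_def)
qed

lemma stalk_germs_eq_at:
  assumes "openin X U" "s \<in> carrier (Sec F U)" "t \<in> carrier (Sec F U)" "x \<in> U"
    and "stalk_germs X F U s x = stalk_germs X F U t x"
  obtains V where "openin X V" "x \<in> V" "V \<subseteq> U" "Res F U V s = Res F U V t"
proof -
  interpret S: presheaf_colimit X F "open_nbhds X x"
    using assms(4) openin_subset[OF assms(1)] by (intro stalk_colimit) auto
  have U: "U \<in> open_nbhds X x" using assms by (simp add: open_nbhds_def)
  have "germ F (open_nbhds X x) U s = germ F (open_nbhds X x) U t"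
    using assms(4,5) by (simp add: stalk_germs_def)
  then obtain V where "V \<in> open_nbhds X x" "V \<subseteq> U \<inter> U" "Res F U V s = Res F U V t"
    using S.germ_eq_iff[OF U U assms(2,3)] by blast
  then show ?thesis by (intro that[of V]) (auto simp: open_nbhds_def)
qed

lemma stalk_germs_closed:
  assumes "openin X U" "s \<in> carrier (Sec F U)"
  shows "stalk_germs X F U s \<in> carrier (Sec (sheafification X F) U)"
proof -
  have "germ F (open_nbhds X x) U s \<in> carrier (stalk X F x)" if "x \<in> U" for x
  proof -
    interpret S: presheaf_colimit X F "open_nbhds X x"
      using that openin_subset[OF assms(1)] by (intro stalk_colimit) auto
    show ?thesis
      unfolding stalk_def using that assms by (intro S.germ_closed) (simp_all add: open_nbhds_def)
  qed
  then have "stalk_germs X F U s \<in> (\<Pi>\<^sub>E x\<in>U. carrier (stalk X F x))"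
    by (auto simp: stalk_germs_def)
  moreover have "restrict (stalk_germs X F U s) U = stalk_germs X F U s"
    by (simp add: stalk_germs_def)
  ultimately show ?thesis
    using assms by (auto simp: sheafification_def intro!: exI[of _ U])
qed

lemma stalk_germs_mult:
  assumes "openin X U" "s \<in> carrier (Sec F U)" "t \<in> carrier (Sec F U)"
  shows "stalk_germs X F U (s \<otimes>\<^bsub>Sec F U\<^esub> t) =
    stalk_germs X F U s \<otimes>\<^bsub>Sec (sheafification X F) U\<^esub> stalk_germs X F U t"
proof -
  have "germ F (open_nbhds X x) U (s \<otimes>\<^bsub>Sec F U\<^esub> t) =
      germ F (open_nbhds X x) U s \<otimes>\<^bsub>stalk X F x\<^esub> germ F (open_nbhds X x) U t"
    if "x \<in> U" for x
  proof -
    interpret S: presheaf_colimit X F "open_nbhds X x"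
      using that openin_subset[OF assms(1)] by (intro stalk_colimit) auto
    show ?thesis
      unfolding stalk_def using that assms
      by (intro S.germ_mult[symmetric]) (simp_all add: open_nbhds_def)
  qed
  then show ?thesis
    by (simp add: sheafification_def stalk_germs_def cong: restrict_cong)
qed

lemma stalk_germs_one:
  assumes "openin X U"
  shows "stalk_germs X F U \<one>\<^bsub>Sec F U\<^esub> = \<one>\<^bsub>Sec (sheafification X F) U\<^esub>"
proof -
  have "germ F (open_nbhds X x) U \<one>\<^bsub>Sec F U\<^esub> = \<one>\<^bsub>stalk X F x\<^esub>" if "x \<in> U" for x
  proof -
    interpret S: presheaf_colimit X F "open_nbhds X x"
      using that openin_subset[OF assms(1)] by (intro stalk_colimit) auto
    show ?thesis
      unfolding stalk_def using that assms by (intro S.germ_one) (simp add: open_nbhds_def)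
  qed
  then show ?thesis
    by (simp add: sheafification_def stalk_germs_def cong: restrict_cong)
qed

end

text \<open>For presheaves the two local conditions amount to bijectivity on stalks. A
  section of the sheafification comes locally from sections of \<open>F\<close>; injectivity, which follows from
  the locality axiom of \<open>F\<close>, makes these agree on overlaps, and the gluing axiom puts them together.\<close>

theorem sheafification_isomorphism:
  assumes F: "ab_sheaf X F" and P: "ab_presheaf X P" and mor: "presheaf_morphism X F P \<theta>"
    and locally_inj: "\<And>U s t x. \<lbrakk>openin X U; s \<in> carrier (Sec F U); t \<in> carrier (Sec F U);
        \<theta> U s = \<theta> U t; x \<in> U\<rbrakk>
      \<Longrightarrow> \<exists>V. openin X V \<and> x \<in> V \<and> V \<subseteq> U \<and> Res F U V s = Res F U V t"
    and locally_surj: "\<And>U p x. \<lbrakk>openin X U; p \<in> carrier (Sec P U); x \<in> U\<rbrakk>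
      \<Longrightarrow> \<exists>V. openin X V \<and> x \<in> V \<and> V \<subseteq> U \<and> (\<exists>s\<in>carrier (Sec F V). Res P U V p = \<theta> V s)"
  shows "sheaf_isomorphism X F (sheafification X P) (\<lambda>U s. stalk_germs X P U (\<theta> U s))"
proof -
  interpret F: ab_sheaf X F by fact
  interpret P: ab_presheaf X P by fact
  define \<alpha> where "\<alpha> = (\<lambda>U s. stalk_germs X P U (\<theta> U s))"
  have \<theta>_hom: "\<theta> U \<in> hom (Sec F U) (Sec P U)" if "openin X U" for U
    using mor that by (simp add: presheaf_morphism_def)
  have \<theta>_Res: "\<theta> V (Res F U V s) = Res P U V (\<theta> U s)"
    if "openin X U" "openin X V" "V \<subseteq> U" "s \<in> carrier (Sec F U)" for U V s
    using mor that by (simp add: presheaf_morphism_def)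
  have \<theta>_closed: "\<theta> U s \<in> carrier (Sec P U)" if "openin X U" "s \<in> carrier (Sec F U)" for U s
    using \<theta>_hom[OF that(1)] that(2) by (rule hom_in_carrier)
  have \<alpha>_closed: "\<alpha> U s \<in> carrier (Sec (sheafification X P) U)"
    if "openin X U" "s \<in> carrier (Sec F U)" for U s
    unfolding \<alpha>_def using P.stalk_germs_closed[OF that(1) \<theta>_closed[OF that]] .
  have \<alpha>_Res: "\<alpha> V (Res F U V s) = restrict (\<alpha> U s) V"
    if "openin X U" "openin X V" "V \<subseteq> U" "s \<in> carrier (Sec F U)" for U V s
    using P.stalk_germs_Res[OF that(1-3) \<theta>_closed[OF that(1,4)]] \<theta>_Res[OF that]
    by (simp add: \<alpha>_def)
  have \<alpha>_inj: "s = t"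
    if U: "openin X U" and s: "s \<in> carrier (Sec F U)" and t: "t \<in> carrier (Sec F U)"
      and eq: "\<alpha> U s = \<alpha> U t" for U s t
  proof -
    define C where "C = {V. openin X V \<and> V \<subseteq> U \<and> Res F U V s = Res F U V t}"
    have "x \<in> \<Union>C" if x: "x \<in> U" for x
    proof -
      obtain V where V: "openin X V" "x \<in> V" "V \<subseteq> U" "Res P U V (\<theta> U s) = Res P U V (\<theta> U t)"
        using P.stalk_germs_eq_at[OF U \<theta>_closed[OF U s] \<theta>_closed[OF U t] x] eq
        by (auto simp: \<alpha>_def)
      then have "\<theta> V (Res F U V s) = \<theta> V (Res F U V t)"
        using \<theta>_Res[OF U V(1,3)] s t by simp
      then obtain V' where V': "openin X V'" "x \<in> V'" "V' \<subseteq> V"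
          "Res F V V' (Res F U V s) = Res F V V' (Res F U V t)"
        using locally_inj[OF V(1) F.Res_closed[OF U V(1,3) s] F.Res_closed[OF U V(1,3) t] _ V(2)]
        by blast
      then have "V' \<in> C"
        using F.Res_Res[OF U V(1) V'(1) V'(3) V(3)] s t V(3) by (auto simp: C_def)
      then show ?thesis using V'(2) by blast
    qed
    then have C: "\<Union>C = U" by (auto simp: C_def)
    show "s = t"
      by (rule F.locality[of C]) (use s t in \<open>simp_all only: C\<close>, auto simp: C_def)
  qed
  have \<alpha>_surj: "\<exists>s\<in>carrier (Sec F U). \<alpha> U s = \<sigma>"
    if U: "openin X U" and \<sigma>: "\<sigma> \<in> carrier (Sec (sheafification X P) U)" for U \<sigma>
  proof -
    define C where "C = {V. openin X V \<and> V \<subseteq> U \<and> (\<exists>s\<in>carrier (Sec F V). restrict \<sigma> V = \<alpha> V s)}"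
    have C_open: "openin X V" and C_sub: "V \<subseteq> U" if "V \<in> C" for V
      using that by (auto simp: C_def)
    have "x \<in> \<Union>C" if x: "x \<in> U" for x
    proof -
      obtain V p where V: "openin X V" "x \<in> V" "V \<subseteq> U"
          and p: "p \<in> carrier (Sec P V)" "restrict \<sigma> V = stalk_germs X P V p"
        using \<sigma> x unfolding sheafification_def by auto
      obtain V' s where V': "openin X V'" "x \<in> V'" "V' \<subseteq> V"
          and s: "s \<in> carrier (Sec F V')" "Res P V V' p = \<theta> V' s"
        using locally_surj[OF V(1) p(1) V(2)] by blast
      have "restrict \<sigma> V' = restrict (restrict \<sigma> V) V'"
        using V'(3) by (simp add: Int_absorb1)
      also have "\<dots> = \<alpha> V' s"
        using P.stalk_germs_Res[OF V(1) V'(1,3) p(1)] p(2) s(2) by (simp add: \<alpha>_def)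
      finally have "V' \<in> C" using V V' s(1) by (auto simp: C_def)
      then show ?thesis using V'(2) by blast
    qed
    then have C: "\<Union>C = U" using C_sub by blast
    have "\<forall>V\<in>C. \<exists>s. s \<in> carrier (Sec F V) \<and> restrict \<sigma> V = \<alpha> V s" by (auto simp: C_def)
    then obtain f where "\<forall>V\<in>C. f V \<in> carrier (Sec F V) \<and> restrict \<sigma> V = \<alpha> V (f V)"
      by (rule bchoice[THEN exE])
    then have f: "f V \<in> carrier (Sec F V)" "\<alpha> V (f V) = restrict \<sigma> V" if "V \<in> C" for V
      using that by auto
    have "\<exists>s\<in>carrier (Sec F (\<Union>C)). \<forall>V\<in>C. Res F (\<Union>C) V s = f V"
    proof (rule F.gluing)
      fix V W assume VW: "V \<in> C" "W \<in> C"
      note op = C_open[OF VW(1)] C_open[OF VW(2)]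
      have VWo: "openin X (V \<inter> W)" using op by (rule openin_Int)
      have "\<alpha> (V \<inter> W) (Res F V (V \<inter> W) (f V)) = restrict \<sigma> (V \<inter> W)"
        using \<alpha>_Res[OF op(1) VWo Int_lower1 f(1)[OF VW(1)]] f(2)[OF VW(1)] by simp
      moreover have "\<alpha> (V \<inter> W) (Res F W (V \<inter> W) (f W)) = restrict \<sigma> (V \<inter> W)"
        using \<alpha>_Res[OF op(2) VWo Int_lower2 f(1)[OF VW(2)]] f(2)[OF VW(2)]
        by (simp add: Int_left_commute)
      ultimately show "Res F V (V \<inter> W) (f V) = Res F W (V \<inter> W) (f W)"
        using \<alpha>_inj[OF VWo F.Res_closed[OF op(1) VWo Int_lower1 f(1)[OF VW(1)]]
            F.Res_closed[OF op(2) VWo Int_lower2 f(1)[OF VW(2)]]] by simp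
    qed (use C_open f in auto)
    then obtain s where s: "s \<in> carrier (Sec F U)" "\<And>V. V \<in> C \<Longrightarrow> Res F U V s = f V"
      unfolding C by blast
    have "\<alpha> U s x = \<sigma> x" for x
    proof (cases "x \<in> U")
      case True
      then obtain V where V: "V \<in> C" "x \<in> V" using C by blast
      have "restrict (\<alpha> U s) V = restrict \<sigma> V"
        using \<alpha>_Res[OF U C_open[OF V(1)] C_sub[OF V(1)] s(1)] s(2)[OF V(1)] f(2)[OF V(1)] by simp
      then show ?thesis using V(2) by (metis restrict_apply')
    next
      case False
      then show ?thesis
        using \<sigma> by (auto simp: \<alpha>_def stalk_germs_def sheafification_def)
    qed
    then show ?thesis using s(1) by blast
  qed
  show ?thesis
    unfolding \<alpha>_def[symmetric]
  proof (rule sheaf_isomorphism_bijective[OF F])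
    show "presheaf_morphism X F (sheafification X P) \<alpha>"
      unfolding presheaf_morphism_def
    proof (intro conjI allI impI ballI)
      fix U assume U: "openin X U"
      show "\<alpha> U \<in> hom (Sec F U) (Sec (sheafification X P) U)"
      proof (rule homI)
        fix s t assume st: "s \<in> carrier (Sec F U)" "t \<in> carrier (Sec F U)"
        show "\<alpha> U (s \<otimes>\<^bsub>Sec F U\<^esub> t) = \<alpha> U s \<otimes>\<^bsub>Sec (sheafification X P) U\<^esub> \<alpha> U t"
          using P.stalk_germs_mult[OF U \<theta>_closed[OF U st(1)] \<theta>_closed[OF U st(2)]]
            hom_mult[OF \<theta>_hom[OF U] st] by (simp add: \<alpha>_def)
      qed (rule \<alpha>_closed[OF U])
    next
      fix U V s assume "openin X U" "openin X V" "V \<subseteq> U" "s \<in> carrier (Sec F U)"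
      then show "\<alpha> V (Res F U V s) = Res (sheafification X P) U V (\<alpha> U s)"
        using \<alpha>_Res by (simp add: sheafification_def)
    qed
  next
    fix U assume U: "openin X U"
    show "bij_betw (\<alpha> U) (carrier (Sec F U)) (carrier (Sec (sheafification X P) U))"
      unfolding bij_betw_def inj_on_def using \<alpha>_inj[OF U] \<alpha>_closed[OF U] \<alpha>_surj[OF U] by blast
    have "\<theta> U \<one>\<^bsub>Sec F U\<^esub> = \<one>\<^bsub>Sec P U\<^esub>"
      using hom_one[OF \<theta>_hom[OF U]] F.Sec_group[OF U] P.Sec_group[OF U]
      by (simp add: comm_group.axioms(2))
    then show "\<alpha> U \<one>\<^bsub>Sec F U\<^esub> = \<one>\<^bsub>Sec (sheafification X P) U\<^esub>"
      using P.stalk_germs_one[OF U] by (simp add: \<alpha>_def)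
  qed
qed


section \<open>Neighbourhoods of the filters of a continuous map\<close>

lemma Filt_basic_mono: "\<lbrakk>openin X U'; U \<subseteq> U'\<rbrakk> \<Longrightarrow> Filt_basic X U \<subseteq> Filt_basic X U'"
  by (auto simp: Filt_basic_def topological_filter_def)

text \<open>A neighbourhood of the filter of \<open>y\<close> contains some basic set of an open \<open>U\<close> belonging to that
  filter, and such a \<open>U\<close> contains the preimage of a neighbourhood of \<open>y\<close>. The intersection with \<open>V\<close>
  lets the conclusion be used for restrictions of sections over \<open>V\<close>.\<close>

lemma filter_of_map_nbhd_base:
  assumes cont: "continuous_map X Y \<phi>"
    and W: "openin (Filt X) W" "filter_of_map X Y \<phi> y \<in> W" and V: "openin Y V" "y \<in> V"
  obtains V' where "openin Y V'" "y \<in> V'" "V' \<subseteq> V" "Filt_basic X (preimage_in X \<phi> V') \<subseteq> W"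
proof -
  have y: "y \<in> topspace Y" using openin_subset[OF V(1)] V(2) by blast
  obtain \<D> where \<D>: "\<And>D. D \<in> \<D> \<Longrightarrow> \<exists>U. openin X U \<and> D = Filt_basic X U" "W = \<Union>\<D>"
    using openin_Filt_obtain[OF W(1)] by metis
  obtain D where D: "D \<in> \<D>" "filter_of_map X Y \<phi> y \<in> D"
    using W(2) unfolding \<D>(2) by (rule UnionE)
  obtain U where DU: "openin X U" "D = Filt_basic X U"
    using \<D>(1)[OF D(1)] by blast
  have U: "openin X U" "Filt_basic X U \<subseteq> W" "filter_of_map X Y \<phi> y \<in> Filt_basic X U"
    using DU D \<D>(2) by auto
  then have "U \<in> filter_of_map X Y \<phi> y" by (simp add: Filt_basic_def)
  then obtain V0 where V0: "openin Y V0" "y \<in> V0" "preimage_in X \<phi> V0 \<subseteq> U"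
    unfolding filter_of_map_eq[OF cont y] by blast
  show ?thesis
  proof (rule that[of "V0 \<inter> V"])
    have "preimage_in X \<phi> (V0 \<inter> V) \<subseteq> U"
      by (rule order_trans[OF preimage_in_mono[OF Int_lower1] V0(3)])
    then show "Filt_basic X (preimage_in X \<phi> (V0 \<inter> V)) \<subseteq> W"
      by (rule order_trans[OF Filt_basic_mono[OF U(1)] U(2)])
  qed (use V0 V in \<open>auto simp: openin_Int\<close>)
qed


section \<open>The comparison map\<close>

theorem mainTheorem6:
  fixes X :: "'a topology" and Y :: "'b topology" and \<phi> :: "'a \<Rightarrow> 'b"
    and G :: "('a, 'g) presheaf"
  assumes "continuous_map X Y \<phi>"
    and "ab_sheaf X G"
  shows "sheaf_isomorphism Y
    (direct_image X \<phi> G)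
    (inverse_image Y (Filt X) (filter_of_map X Y \<phi>) (direct_image X (open_nbhds X) G))
    (canonical_comparison X Y \<phi> G)"
proof -
  interpret G: ab_sheaf X G by fact
  let ?H = "direct_image X (open_nbhds X) G" and ?D = "direct_image X \<phi> G"
  let ?\<psi> = "filter_of_map X Y \<phi>"
  let ?I = "open_nbhds_image (Filt X) ?\<psi>" and ?P = "inverse_image_presheaf (Filt X) ?\<psi> ?H"
  let ?B = "\<lambda>V. Filt_basic X (preimage_in X \<phi> V)"
  \<comment> \<open>the presheaf level of the comparison map; sections of \<open>?D\<close> over \<open>V\<close> are
    sections of \<open>?H\<close> over \<open>?B V\<close>\<close>
  define \<theta> where "\<theta> = (\<lambda>V. germ ?H (?I V) (?B V))"
  note \<psi>_cont = continuous_map_filter_of_map[OF assms(1)]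
  interpret H: ab_presheaf "Filt X" ?H
    by (rule ab_presheaf_direct_image[OF G.ab_presheaf_axioms continuous_map_open_nbhds])
  have pre: "openin X (preimage_in X \<phi> V)" if "openin Y V" for V
    using openin_preimage_in[OF assms(1) that] .
  have B_open: "openin (Filt X) (?B V)" if "openin Y V" for V
    using openin_Filt_basic[OF pre[OF that]] .
  have B_mem: "?B V \<in> ?I V" if "openin Y V" for V
    using Filt_basic_in_open_nbhds_image[OF assms(1) that] .
  have B_mono: "?B V' \<subseteq> ?B V" if "openin Y V" "V' \<subseteq> V" for V V'
    using Filt_basic_mono[OF pre[OF that(1)] preimage_in_mono[OF that(2)]] .
  have \<psi>_sub: "?\<psi> ` V \<subseteq> topspace (Filt X)" if "openin Y V" for V
    using \<psi>_cont openin_subset[OF that] by (auto simp: continuous_map_def)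
  have I_mono: "?I V \<subseteq> ?I V'" if "V' \<subseteq> V" for V V'
    using that by (auto simp: open_nbhds_image_def)
  have I_openin: "openin (Filt X) W" if "W \<in> ?I V" for V W
    using that by (simp add: open_nbhds_image_def)
  have col: "presheaf_colimit (Filt X) ?H (?I V)" if "openin Y V" for V
    by (rule H.image_colimit[OF \<psi>_sub[OF that]])
  have Sec_H: "Sec ?H (?B V) = Sec ?D V" if "openin Y V" for V
    by (simp add: direct_image_def preimage_in_Filt_basic[OF pre[OF that]])
  have Res_H: "Res ?H (?B V) (?B V') = Res ?D V V'" if "openin Y V" "openin Y V'" for V V'
    by (simp add: direct_image_def preimage_in_Filt_basic[OF pre] that)
  have Sec_P: "Sec ?P V = direct_limit ?H (?I V)" for V
    by (simp add: inverse_image_presheaf_def)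
  have \<theta>_mor: "presheaf_morphism Y ?D ?P \<theta>"
    unfolding presheaf_morphism_def
  proof (intro conjI allI impI ballI)
    fix V assume V: "openin Y V"
    interpret C: presheaf_colimit "Filt X" ?H "?I V" by (rule col[OF V])
    show "\<theta> V \<in> hom (Sec ?D V) (Sec ?P V)"
    proof (rule homI)
      fix s t assume st: "s \<in> carrier (Sec ?D V)" "t \<in> carrier (Sec ?D V)"
      show "\<theta> V s \<in> carrier (Sec ?P V)"
        using C.germ_closed[OF B_mem[OF V]] st(1) by (simp add: \<theta>_def Sec_P Sec_H[OF V])
      show "\<theta> V (s \<otimes>\<^bsub>Sec ?D V\<^esub> t) = \<theta> V s \<otimes>\<^bsub>Sec ?P V\<^esub> \<theta> V t"
        using C.germ_mult[OF B_mem[OF V]] st by (simp add: \<theta>_def Sec_P Sec_H[OF V])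
    qed
  next
    fix V V' s assume V: "openin Y V" "openin Y V'" "V' \<subseteq> V" and s: "s \<in> carrier (Sec ?D V)"
    interpret C: presheaf_colimit "Filt X" ?H "?I V'" by (rule col[OF V(2)])
    have s': "s \<in> carrier (Sec ?H (?B V))" using s Sec_H[OF V(1)] by simp
    have BV: "?B V \<in> ?I V'" using B_mem[OF V(1)] I_mono[OF V(3)] by blast
    have "Res ?P V V' (\<theta> V s) = germ ?H (?I V') (?B V) s"
      unfolding \<theta>_def
      by (rule H.inverse_image_presheaf_Res_germ[OF \<psi>_sub[OF V(1)] V(3) B_mem[OF V(1)] s'])
    also have "\<dots> = germ ?H (?I V') (?B V') (Res ?H (?B V) (?B V') s)"
      by (rule C.germ_Res[OF BV B_mem[OF V(2)] B_mono[OF V(1,3)] s', symmetric])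
    finally show "\<theta> V' (Res ?D V V' s) = Res ?P V V' (\<theta> V s)"
      by (simp add: \<theta>_def Res_H[OF V(1,2)])
  qed
  have locally_inj: "\<exists>V'. openin Y V' \<and> y \<in> V' \<and> V' \<subseteq> V \<and> Res ?D V V' s = Res ?D V V' t"
    if V: "openin Y V" and s: "s \<in> carrier (Sec ?D V)" and t: "t \<in> carrier (Sec ?D V)"
      and eq: "\<theta> V s = \<theta> V t" and y: "y \<in> V" for V s t y
  proof -
    interpret C: presheaf_colimit "Filt X" ?H "?I V" by (rule col[OF V])
    have s': "s \<in> carrier (Sec ?H (?B V))" and t': "t \<in> carrier (Sec ?H (?B V))"
      using s t Sec_H[OF V] by simp_all
    obtain W where W: "W \<in> ?I V" "W \<subseteq> ?B V" "Res ?H (?B V) W s = Res ?H (?B V) W t"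
      using C.germ_eq_iff[OF B_mem[OF V] B_mem[OF V] s' t'] eq by (auto simp: \<theta>_def)
    have "?\<psi> y \<in> W" using W(1) y by (auto simp: open_nbhds_image_def)
    then obtain V' where V': "openin Y V'" "y \<in> V'" "V' \<subseteq> V" "?B V' \<subseteq> W"
      using filter_of_map_nbhd_base[OF assms(1) I_openin[OF W(1)] _ V y] by metis
    have "Res ?H (?B V) (?B V') s = Res ?H (?B V) (?B V') t"
      using H.Res_Res[OF B_open[OF V] I_openin[OF W(1)] B_open[OF V'(1)] V'(4) W(2) s']
        H.Res_Res[OF B_open[OF V] I_openin[OF W(1)] B_open[OF V'(1)] V'(4) W(2) t'] W(3) by simp
    then show ?thesis using V' Res_H[OF V V'(1)] by auto
  qed
  have locally_surj:
    "\<exists>V'. openin Y V' \<and> y \<in> V' \<and> V' \<subseteq> V \<and> (\<exists>s\<in>carrier (Sec ?D V'). Res ?P V V' p = \<theta> V' s)"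
    if V: "openin Y V" and p: "p \<in> carrier (Sec ?P V)" and y: "y \<in> V" for V p y
  proof -
    obtain W s where W: "W \<in> ?I V" "s \<in> carrier (Sec ?H W)" "p = germ ?H (?I V) W s"
      using p unfolding Sec_P by (rule presheaf_colimit.direct_limit_cases[OF col[OF V]])
    have "?\<psi> y \<in> W" using W(1) y by (auto simp: open_nbhds_image_def)
    then obtain V' where V': "openin Y V'" "y \<in> V'" "V' \<subseteq> V" "?B V' \<subseteq> W"
      using filter_of_map_nbhd_base[OF assms(1) I_openin[OF W(1)] _ V y] by metis
    interpret C: presheaf_colimit "Filt X" ?H "?I V'" by (rule col[OF V'(1)])
    have "Res ?P V V' p = germ ?H (?I V') W s"
      using H.inverse_image_presheaf_Res_germ[OF \<psi>_sub[OF V] V'(3) W(1,2)] W(3) by simp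
    also have "\<dots> = \<theta> V' (Res ?H W (?B V') s)"
      unfolding \<theta>_def using W(1) I_mono[OF V'(3)]
      by (intro C.germ_Res[OF _ B_mem[OF V'(1)] V'(4) W(2), symmetric]) blast
    finally have "Res ?P V V' p = \<theta> V' (Res ?H W (?B V') s)" .
    moreover have "Res ?H W (?B V') s \<in> carrier (Sec ?D V')"
      using H.Res_closed[OF I_openin[OF W(1)] B_open[OF V'(1)] V'(4) W(2)] Sec_H[OF V'(1)] by simp
    ultimately show ?thesis using V' by blast
  qed
  have "sheaf_isomorphism Y ?D (sheafification Y ?P) (\<lambda>V s. stalk_germs Y ?P V (\<theta> V s))"
    by (rule sheafification_isomorphism[OF ab_sheaf_direct_image[OF assms(2,1)]
          ab_presheaf_inverse_image_presheaf[OF H.ab_presheaf_axioms \<psi>_cont] \<theta>_mor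
          locally_inj locally_surj])
  moreover have "canonical_comparison X Y \<phi> G = (\<lambda>V s. stalk_germs Y ?P V (\<theta> V s))"
    by (intro ext) (simp add: canonical_comparison_def \<theta>_def Let_def)
  ultimately show ?thesis by (simp add: inverse_image_def)
qed

end
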